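(* Let $S\subseteq\{1,2,\dots,\lfloor N/2\rfloor\}$ and let $C_N(S)$ be the undirected circulant graph with vertex set $\{0,1,\dots,N-1\}$ and step-set $S$. Let $d$ be the common degree of its nodes, let $\omega_N=e^{-2\pi \mathrm{i}/N}$ ($\mathrm{i}$ the imaginary unit), and for $1\le k\le N$ let $$\lambda_k=d-2\sum_{s\in S}\cos\left(\frac{2\pi s(k-1)}{N}\right).$$ Then the transition matrix of heat diffusion on $C_N(S)$ has entries, for $i,j\in\{0,\dots,N-1\}$ and $t\ge 0$, $$T_{i,j}(t)=\frac1N\sum_{k=0}^{N-1}\exp(-t\lambda_{k+1})\,\omega_N^{\,k((j-i)\bmod N)} .$$
   Context: The circulant graph $C_N(S)$ has vertex set $V=\{0,1,\dots,N-1\}$ and edge set $\{\{i,j\}\subseteq V : j-i\equiv s \pmod N \text{ for some } s\in S\}$. Every node has degree $d=2|S|$ if $N$ is odd or $N/2\notin S$, and $d=2|S|-1$ if $N$ is even and $N/2\in S$. The combinatorial Laplacian $\mathbf{L}$ of a graph has entries $L_{i,i}=d_i$ (the degree of node $i$), $L_{i,j}=-1$ if $i\neq j$ and $i,j$ are joined by an edge, and $L_{i,j}=0$ otherwise. Heat diffusion is the continuous-time homogeneous Markov chain on the nodes whose probability vector satisfies $\frac{d}{dt}\mathbf{p}^{\intercal}(t)=-\mathbf{p}^{\intercal}(t)\mathbf{L}$ (diffusion rate equal to 1), so its transition matrix over a time $t$ is $\mathbf{T}(t)=e^{-t\mathbf{L}}$.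
   Formalization: When N is even and N/2 ∈ S, the stated λ_k is false (λ_1 = -1 gives row sums e^t), so there the cosine of s = N/2 is counted once instead of twice in λ_k; all other cases are as stated. *)

theory Defs
  imports Complex_Main "HOL-Number_Theory.Cong" "Jordan_Normal_Form.Matrix"
begin

section \<open>Simple graphs on an initial segment of the naturals and their Laplacian\<close>

text \<open>A simple graph on the vertex set \<open>{0..<n}\<close> is given by its set of edges, each edge being a
  two-element set of vertices.\<close>

definition node_degree :: "nat set set \<Rightarrow> nat \<Rightarrow> nat" where
  "node_degree E v = card {e \<in> E. v \<in> e}"

definition laplacian :: "nat \<Rightarrow> nat set set \<Rightarrow> real mat" where
  "laplacian n E = mat n n (\<lambda>(i, j).
     if i = j then real (node_degree E i) else if {i, j} \<in> E then - 1 else 0)"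

section \<open>Matrix exponential and heat diffusion\<close>

text \<open>Matrices of variable dimension do not form a normed algebra, so the exponential series is
  summed entrywise; it always converges, see \<open>mat_exp_summable\<close> below.\<close>

definition mat_exp :: "real mat \<Rightarrow> real mat" where
  "mat_exp A = mat (dim_row A) (dim_row A) (\<lambda>(i, j). \<Sum>m. (A ^\<^sub>m m) $$ (i, j) / fact m)"

definition heat_transition :: "nat \<Rightarrow> nat set set \<Rightarrow> real \<Rightarrow> real mat" where
  "heat_transition n E t = mat_exp ((- t) \<cdot>\<^sub>m laplacian n E)"

section \<open>Circulant graphs\<close>

definition circulant_edges :: "nat \<Rightarrow> nat set \<Rightarrow> nat set set" where
  "circulant_edges N S =
     {{i, j} | i j. i < N \<and> j < N \<and> (\<exists>s\<in>S. [int j - int i = int s] (mod int N))}"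

text \<open>Lemma \<open>degree_circulant\<close> below shows that this is the degree of every node.\<close>

definition circulant_degree :: "nat \<Rightarrow> nat set \<Rightarrow> nat" where
  "circulant_degree N S = (if even N \<and> N div 2 \<in> S then 2 * card S - 1 else 2 * card S)"

definition omega :: "nat \<Rightarrow> complex" where
  "omega N = exp (- 2 * complex_of_real pi * \<i> / of_nat N)"

text \<open>The index \<open>k\<close> runs from \<open>1\<close> to \<open>N\<close>.\<close>

definition circulant_eigval :: "nat \<Rightarrow> nat set \<Rightarrow> nat \<Rightarrow> real" where
  "circulant_eigval N S k =
     real (circulant_degree N S) - 2 * (\<Sum>s\<in>S. cos (2 * pi * real s * (real k - 1) / real N))"

text \<open>If \<open>N\<close> is even and \<open>N div 2 \<in> S\<close>, the steps \<open>N div 2\<close> and \<open>- (N div 2)\<close> coincide modulo \<open>N\<close>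
  and contribute one edge per node (hence the odd degree), so their cosine has weight \<open>1\<close> in
  the spectrum and not \<open>2\<close>: \<open>circulant_eigval N S 1\<close> would be \<open>- 1\<close>, whereas the row sums
  of the Laplacian vanish.\<close>

definition circulant_eigval_half :: "nat \<Rightarrow> nat set \<Rightarrow> nat \<Rightarrow> real" where
  "circulant_eigval_half N S k =
     real (circulant_degree N S)
       - 2 * (\<Sum>s\<in>S - {N div 2}. cos (2 * pi * real s * (real k - 1) / real N))
       - cos (2 * pi * real (N div 2) * (real k - 1) / real N)"

section \<open>The definitions are meaningful\<close>

lemma mat_exp_summable:
  fixes A :: "real mat"
  assumes A: "A \<in> carrier_mat n n" and ij: "i < n" "j < n"
  shows "summable (\<lambda>m. (A ^\<^sub>m m) $$ (i, j) / fact m)"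
proof -
  define M where "M = (\<Sum>a<n. \<Sum>b<n. \<bar>A $$ (a, b)\<bar>)"
  have M0: "M \<ge> 0" unfolding M_def by (simp add: sum_nonneg)
  have entry: "\<bar>A $$ (a, b)\<bar> \<le> M" if "a < n" "b < n" for a b
  proof -
    have "\<bar>A $$ (a, b)\<bar> \<le> (\<Sum>b<n. \<bar>A $$ (a, b)\<bar>)"
      using that by (intro member_le_sum) auto
    also have "\<dots> \<le> M" unfolding M_def
      using that by (intro member_le_sum[of a _ "\<lambda>a. \<Sum>b<n. \<bar>A $$ (a, b)\<bar>"]) (auto simp: sum_nonneg)
    finally show ?thesis .
  qed
  have pw: "\<bar>(A ^\<^sub>m m) $$ (a, b)\<bar> \<le> (real n * M) ^ m" if "a < n" "b < n" for m a b
    using that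
  proof (induction m arbitrary: a b)
    case 0
    then show ?case using A by auto
  next
    case (Suc m)
    have P: "A ^\<^sub>m m \<in> carrier_mat n n" using A by simp
    have "(A ^\<^sub>m Suc m) $$ (a, b) = (\<Sum>c<n. (A ^\<^sub>m m) $$ (a, c) * A $$ (c, b))"
      using P A Suc.prems by (simp add: scalar_prod_def atLeast0LessThan)
    also have "\<bar>\<dots>\<bar> \<le> (\<Sum>c<n. \<bar>(A ^\<^sub>m m) $$ (a, c)\<bar> * \<bar>A $$ (c, b)\<bar>)"
      by (rule order_trans[OF sum_abs]) (simp add: abs_mult)
    also have "\<dots> \<le> (\<Sum>c<n. (real n * M) ^ m * M)"
      using Suc entry M0 by (intro sum_mono mult_mono) auto
    also have "\<dots> = (real n * M) ^ Suc m" by simp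
    finally show ?case .
  qed
  show ?thesis
  proof (rule summable_comparison_test')
    show "summable (\<lambda>m. inverse (fact m) * (real n * M) ^ m)" by (rule summable_exp)
    show "norm ((A ^\<^sub>m m) $$ (i, j) / fact m) \<le> inverse (fact m) * (real n * M) ^ m"
      if "m \<ge> 0" for m
      using pw[OF ij, of m] by (simp add: field_simps)
  qed
qed

lemma degree_circulant:
  assumes S: "S \<subseteq> {1..N div 2}" and v: "v < N"
  shows "node_degree (circulant_edges N S) v = circulant_degree N S"
proof -
  define R where "R = (\<lambda>s. N - s) ` S"
  define f where "f = (\<lambda>r. {v, (v + r) mod N})"
  have fin: "finite S" using S finite_subset by blast
  have range: "S \<union> R \<subseteq> {1..<N}" using S v unfolding R_def by force
  have offset: "(v + r) mod N = (if v + r < N then v + r else v + r - N)" if "r < N" for r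
    using that v by (simp add: mod_if)
  have inj: "inj_on f (S \<union> R)"
  proof (rule inj_onI)
    fix x y assume xy: "x \<in> S \<union> R" "y \<in> S \<union> R" and eq: "f x = f y"
    from xy range have "x \<ge> 1" "x < N" "y \<ge> 1" "y < N" by auto
    then show "x = y" using eq offset[of x] offset[of y] v
      by (auto simp: f_def doubleton_eq_iff split: if_splits)
  qed
  have step: "(\<exists>s\<in>S. [int j - int i = int s] (mod int N)) \<longleftrightarrow>
      (\<exists>s\<in>S. j = (i + s) mod N)" if "i < N" "j < N" for i j
  proof (intro bex_cong refl)
    fix s assume "s \<in> S"
    have "[int j - int i = int s] (mod int N) \<longleftrightarrow> [int j = int (i + s)] (mod int N)"
      by (simp add: cong_iff_dvd_diff algebra_simps)
    also have "\<dots> \<longleftrightarrow> [j = i + s] (mod N)" by (rule cong_int_iff)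
    also have "\<dots> \<longleftrightarrow> j = (i + s) mod N" using that by (simp add: cong_def)
    finally show "[int j - int i = int s] (mod int N) \<longleftrightarrow> j = (i + s) mod N" .
  qed
  have bk: "v = (u + s) mod N \<longleftrightarrow> u = (v + (N - s)) mod N" if "u < N" "s \<in> S" for u s
  proof -
    have "1 \<le> s" "s < N" using that range by auto
    then show ?thesis using that v by (auto simp: mod_if)
  qed
  have "{e \<in> circulant_edges N S. v \<in> e} = f ` (S \<union> R)"
  proof (intro Set.set_eqI iffI)
    fix e assume "e \<in> {e \<in> circulant_edges N S. v \<in> e}"
    then obtain i j where e: "e = {i, j}" "i < N" "j < N" "v \<in> {i, j}"
      and ex: "\<exists>s\<in>S. j = (i + s) mod N"
      unfolding circulant_edges_def using step by blast
    from ex obtain s where s: "s \<in> S" "j = (i + s) mod N" by blast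
    show "e \<in> f ` (S \<union> R)"
    proof (cases "v = i")
      case True
      then show ?thesis using s e by (auto simp: f_def)
    next
      case False
      then have "v = j" using e by auto
      then have "i = (v + (N - s)) mod N" using bk[of i s] s e by auto
      moreover have "N - s \<in> R" using s by (auto simp: R_def)
      ultimately show ?thesis using \<open>v = j\<close> e by (auto simp: f_def insert_commute)
    qed
  next
    fix e assume "e \<in> f ` (S \<union> R)"
    then obtain r where r: "r \<in> S \<union> R" "e = {v, (v + r) mod N}" by (auto simp: f_def)
    define u where "u = (v + r) mod N"
    have u: "u < N" using v by (simp add: u_def)
    have "(\<exists>s\<in>S. u = (v + s) mod N) \<or> (\<exists>s\<in>S. v = (u + s) mod N)"
    proof (cases "r \<in> S")
      case True
      then show ?thesis by (auto simp: u_def)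
    next
      case False
      then obtain s where "s \<in> S" "r = N - s" using r by (auto simp: R_def)
      then show ?thesis using bk[of u s] u by (auto simp: u_def)
    qed
    then have "(\<exists>s\<in>S. [int u - int v = int s] (mod int N)) \<or>
        (\<exists>s\<in>S. [int v - int u = int s] (mod int N))"
      using step[of v u] step[of u v] u v by simp
    then have "{v, u} \<in> circulant_edges N S"
    proof
      assume "\<exists>s\<in>S. [int u - int v = int s] (mod int N)"
      then show ?thesis unfolding circulant_edges_def using u v by blast
    next
      assume "\<exists>s\<in>S. [int v - int u = int s] (mod int N)"
      then have "{u, v} \<in> circulant_edges N S" unfolding circulant_edges_def using u v by blast
      then show ?thesis by (simp add: insert_commute)
    qed
    then show "e \<in> {e \<in> circulant_edges N S. v \<in> e}" using r by (auto simp: u_def)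
  qed
  then have deg: "node_degree (circulant_edges N S) v = card (S \<union> R)"
    unfolding node_degree_def using card_image[OF inj] by simp
  have "inj_on (\<lambda>s. N - s) S"
  proof (rule inj_onI)
    fix x y assume "x \<in> S" "y \<in> S" "N - x = N - y"
    moreover from this have "x < N" "y < N" using range by auto
    ultimately show "x = y" by linarith
  qed
  then have cR: "card R = card S" unfolding R_def by (rule card_image)
  have SR: "S \<inter> R = (if even N \<and> N div 2 \<in> S then {N div 2} else {})"
  proof -
    have half: "x = N div 2 \<and> even N" if x: "x \<in> S" "x \<in> R" for x
    proof -
      obtain s where s: "s \<in> S" "x = N - s" using x by (auto simp: R_def)
      then have "s \<le> N div 2" "x \<le> N div 2" using S x by auto
      then show ?thesis using s by presburger
    qed
    moreover have "N div 2 \<in> R" if "even N" "N div 2 \<in> S"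
    proof -
      have "N div 2 = N - N div 2" using that by presburger
      then show ?thesis using that unfolding R_def by blast
    qed
    ultimately show ?thesis by auto
  qed
  have "card S + card R = card (S \<union> R) + card (S \<inter> R)"
    by (rule card_Un_Int) (simp_all add: fin R_def)
  then show ?thesis unfolding deg circulant_degree_def using cR SR by (auto split: if_splits)
qed

end

theory Submission
  imports Defs
begin

text \<open>The Laplacian of \<open>C\<^sub>N(S)\<close> is a circulant matrix: its entry at \<open>(i, j)\<close> depends only on
  \<open>(i - j) mod N\<close>. All circulant matrices of size \<open>N\<close> are diagonalised by the same vectors, the
  characters \<open>j \<mapsto> \<omega>\<^sup>k\<^sup>j\<close> of the cyclic group \<open>\<int>/N\<close>, and the eigenvalue for the character \<open>k\<close> is the
  discrete Fourier transform of the first column at \<open>k\<close> (\<open>circulant_eigenvector\<close>).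
  Together with the orthogonality of characters, which expands the identity matrix, this gives the
  Fourier expansion of every power of the matrix (\<open>circulant_power\<close>), and summing the exponential
  series eigenvalue by eigenvalue gives that of its exponential (\<open>circulant_exp\<close>).

  It remains to compute the Fourier transform of the first column of the Laplacian. This column is
  the degree at \<open>0\<close> minus the indicator of the set of steps \<open>S \<union> (N - S)\<close>. The steps \<open>s\<close>
  and \<open>N - s\<close> carry conjugate powers of \<open>\<omega>\<close>, so each such pair contributes twice a cosine; only the
  step \<open>N / 2\<close> is its own partner, which is why its cosine occurs once
  (\<open>sum_circulant_steps\<close>, \<open>sum_circulant_steps_half\<close>).\<close>

section \<open>Roots of unity\<close>

lemma omega_power: "omega N ^ n = cis (- (2 * pi * real n / real N))"
proof -
  have "omega N = cis (- 2 * pi / real N)"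
    unfolding omega_def cis_conv_exp by (simp add: mult_ac)
  then show ?thesis by (simp add: DeMoivre mult_ac)
qed

lemma omega_power_N: "omega N ^ N = 1"
  by (cases "N = 0") (simp_all add: omega_power complex_eq_iff)

lemma omega_power_cong:
  assumes "[m = n] (mod N)"
  shows "omega N ^ (k * m) = omega N ^ (k * n)"
proof -
  have red: "omega N ^ (k * m) = omega N ^ (k * (m mod N))" for m
  proof -
    have "k * m = N * (k * (m div N)) + k * (m mod N)"
      by (metis add_mult_distrib2 mult.left_commute mult_div_mod_eq)
    then show ?thesis by (simp add: power_add power_mult omega_power_N)
  qed
  show ?thesis using assms red[of m] red[of n] by (simp add: cong_def)
qed

lemma omega_power_neq_1:
  assumes "0 < n" "n < N"
  shows "omega N ^ n \<noteq> 1"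
proof
  assume "omega N ^ n = 1"
  then have "cos (2 * pi * real n / real N) = 1"
    by (simp add: omega_power complex_eq_iff)
  then obtain q :: int where "2 * pi * real n / real N = real_of_int q * 2 * pi"
    using cos_one_2pi_int by blast
  then have "real n = real_of_int q * real N"
    using assms by (simp add: field_simps)
  then have q: "int n = q * int N"
    by (metis of_int_eq_iff of_int_mult of_int_of_nat_eq)
  then have "int N dvd int n" by simp
  then show False using assms by (simp add: dvd_imp_le leD)
qed

text \<open>Orthogonality of the trivial character and the character \<open>n\<close>: a geometric sum.\<close>

lemma sum_omega_power:
  assumes "n < N"
  shows "(\<Sum>k<N. omega N ^ (k * n)) = (if n = 0 then of_nat N else 0)"
proof (cases "n = 0")
  case False
  have "(omega N ^ n) ^ N = 1"
    by (metis mult.commute omega_power_N power_mult power_one)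
  moreover have "omega N ^ n \<noteq> 1" using omega_power_neq_1 assms False by simp
  moreover have "(\<Sum>k<N. omega N ^ (k * n)) = (\<Sum>k<N. (omega N ^ n) ^ k)"
    by (simp add: power_mult[symmetric] mult.commute)
  ultimately show ?thesis using False geometric_sum[of "omega N ^ n" N] by simp
qed simp

section \<open>Circulant matrices\<close>

text \<open>The difference is taken in the integers because subtraction of naturals truncates; the result
  is the exponent \<open>(j - i) mod N\<close> of the heat kernel.\<close>

definition offset :: "nat \<Rightarrow> nat \<Rightarrow> nat \<Rightarrow> nat" where
  "offset N i j = nat ((int j - int i) mod int N)"

lemma offset_less: "0 < N \<Longrightarrow> offset N i j < N"
  by (simp add: offset_def nat_less_iff)

lemma offset_cong:
  assumes "0 < N"
  shows "[i + offset N i j = j] (mod N)"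
proof -
  have "int (i + offset N i j) = int i + (int j - int i) mod int N"
    using assms by (simp add: offset_def)
  then have "[int (i + offset N i j) = int j] (mod int N)"
    by (simp add: cong_def mod_add_right_eq)
  then show ?thesis by (simp only: cong_int_iff)
qed

lemma offset_add_mod:
  assumes "r < N"
  shows "offset N j ((j + r) mod N) = r"
proof -
  have "(int ((j + r) mod N) - int j) mod int N = int r mod int N"
    by (simp add: zmod_int mod_diff_left_eq)
  then show ?thesis using assms by (simp add: offset_def)
qed

lemma offset_eq_0_iff:
  assumes "i < N" "j < N"
  shows "offset N i j = 0 \<longleftrightarrow> i = j"
proof
  assume "offset N i j = 0"
  then show "i = j" using offset_cong[of N i j] assms by (simp add: cong_def)
qed (simp add: offset_def)

lemma omega_power_offset:
  assumes "0 < N"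
  shows "omega N ^ (k * j) = omega N ^ (k * i) * omega N ^ (k * offset N i j)"
  using omega_power_cong[OF offset_cong[OF assms, of i j], of k]
  by (simp add: power_add distrib_left)

lemma bij_betw_add_mod: "bij_betw (\<lambda>r. (j + r) mod N) {..<N} {..<N :: nat}"
proof (rule bij_betw_byWitness[where f' = "offset N j"])
  show "\<forall>c\<in>{..<N}. (j + offset N j c) mod N = c"
    using offset_cong[of N j] by (auto simp: cong_def)
qed (auto simp: offset_add_mod offset_less)

definition dft :: "nat \<Rightarrow> (nat \<Rightarrow> real) \<Rightarrow> nat \<Rightarrow> complex" where
  "dft N a k = (\<Sum>r<N. of_real (a r) * omega N ^ (k * r))"

text \<open>Translating the summation index by \<open>j\<close> turns the product of a character with a column of a
  circulant matrix into the value of the character at \<open>j\<close> times the transform of the first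
  column.\<close>

lemma circulant_eigenvector:
  "(\<Sum>c<N. omega N ^ (k * c) * of_real (a (offset N j c))) = dft N a k * omega N ^ (k * j)"
proof -
  have "(\<Sum>c<N. omega N ^ (k * c) * of_real (a (offset N j c)))
      = (\<Sum>r<N. omega N ^ (k * ((j + r) mod N)) * of_real (a (offset N j ((j + r) mod N))))"
    by (rule sum.reindex_bij_betw[OF bij_betw_add_mod, symmetric])
  also have "\<dots> = (\<Sum>r<N. omega N ^ (k * (j + r)) * of_real (a r))"
  proof (rule sum.cong[OF refl])
    fix r assume "r \<in> {..<N}"
    then show "omega N ^ (k * ((j + r) mod N)) * of_real (a (offset N j ((j + r) mod N)))
        = omega N ^ (k * (j + r)) * of_real (a r)"
      using omega_power_cong[of "(j + r) mod N" "j + r" N k]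
      by (simp add: offset_add_mod cong_def)
  qed
  also have "\<dots> = dft N a k * omega N ^ (k * j)"
    unfolding dft_def sum_distrib_right
    by (rule sum.cong[OF refl]) (simp add: distrib_left power_add)
  finally show ?thesis .
qed

text \<open>Each further factor of the matrix meets, in every summand, the row vector of a character, and
  multiplies it by its eigenvalue. The zeroth power is orthogonality.\<close>

lemma circulant_power:
  fixes A :: "real mat"
  assumes A: "A \<in> carrier_mat N N"
    and circ: "\<And>i j. i < N \<Longrightarrow> j < N \<Longrightarrow> A $$ (i, j) = a (offset N j i)"
    and ij: "i < N" "j < N"
  shows "of_real ((A ^\<^sub>m m) $$ (i, j)) =
    1 / of_nat N * (\<Sum>k<N. dft N a k ^ m * omega N ^ (k * offset N i j))"
  using ij(2)
proof (induction m arbitrary: j)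
  case 0
  then show ?case
    using A ij(1) by (simp add: sum_omega_power offset_less offset_eq_0_iff)
next
  case (Suc m)
  have N: "0 < N" using ij by simp
  have nz: "omega N \<noteq> 0" using omega_power[of N 1] by simp
  have row: "(\<Sum>c<N. omega N ^ (k * offset N i c) * of_real (a (offset N j c)))
      = dft N a k * omega N ^ (k * offset N i j)" for k
  proof -
    have "omega N ^ (k * i) * (\<Sum>c<N. omega N ^ (k * offset N i c) * of_real (a (offset N j c)))
        = (\<Sum>c<N. omega N ^ (k * c) * of_real (a (offset N j c)))"
      unfolding sum_distrib_left
      by (simp only: mult.assoc[symmetric] omega_power_offset[OF N, of k _ i, symmetric])
    also have "\<dots> = omega N ^ (k * i) * (dft N a k * omega N ^ (k * offset N i j))"
      unfolding circulant_eigenvector omega_power_offset[OF N, of k j i]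
      by (simp only: mult_ac)
    finally show ?thesis using nz by simp
  qed
  have P: "A ^\<^sub>m m \<in> carrier_mat N N" using A by simp
  have "(A ^\<^sub>m Suc m) $$ (i, j) = (\<Sum>c<N. (A ^\<^sub>m m) $$ (i, c) * A $$ (c, j))"
    using P A ij(1) Suc.prems by (simp add: scalar_prod_def atLeast0LessThan)
  then have "of_real ((A ^\<^sub>m Suc m) $$ (i, j))
      = (\<Sum>c<N. of_real ((A ^\<^sub>m m) $$ (i, c)) * (of_real (a (offset N j c)) :: complex))"
    using circ Suc.prems by simp
  also have "\<dots> = (\<Sum>c<N. \<Sum>k<N. 1 / of_nat N * (dft N a k ^ m *
      (omega N ^ (k * offset N i c) * of_real (a (offset N j c)))))"
    by (rule sum.cong[OF refl]) (simp add: Suc.IH sum_distrib_left sum_distrib_right mult_ac)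
  also have "\<dots> = 1 / of_nat N * (\<Sum>k<N. dft N a k ^ m *
      (\<Sum>c<N. omega N ^ (k * offset N i c) * of_real (a (offset N j c))))"
    unfolding sum_distrib_left by (rule sum.swap)
  also have "\<dots> = 1 / of_nat N * (\<Sum>k<N. dft N a k ^ Suc m * omega N ^ (k * offset N i j))"
    unfolding row by (simp add: mult_ac)
  finally show ?case .
qed

lemma circulant_exp:
  fixes A :: "real mat"
  assumes A: "A \<in> carrier_mat N N"
    and circ: "\<And>i j. i < N \<Longrightarrow> j < N \<Longrightarrow> A $$ (i, j) = a (offset N j i)"
    and ij: "i < N" "j < N"
  shows "of_real (mat_exp A $$ (i, j)) =
    1 / of_nat N * (\<Sum>k<N. exp (dft N a k) * omega N ^ (k * offset N i j))"
proof -
  have "(\<lambda>m. (A ^\<^sub>m m) $$ (i, j) / fact m) sums (mat_exp A $$ (i, j))"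
    using mat_exp_summable[OF A ij] A ij by (simp add: mat_exp_def summable_sums)
  then have "(\<lambda>m. complex_of_real ((A ^\<^sub>m m) $$ (i, j) / fact m))
      sums of_real (mat_exp A $$ (i, j))"
    by (rule sums_of_real)
  moreover have "complex_of_real ((A ^\<^sub>m m) $$ (i, j) / fact m) = 1 / of_nat N *
      (\<Sum>k<N. (dft N a k ^ m /\<^sub>R fact m) * omega N ^ (k * offset N i j))" for m
    using circulant_power[where a = a, OF A circ ij, of m]
    by (simp add: sum_divide_distrib[symmetric] scaleR_conv_of_real divide_inverse
        sum_distrib_left mult_ac)
  moreover have "(\<lambda>m. 1 / of_nat N *
      (\<Sum>k<N. (dft N a k ^ m /\<^sub>R fact m) * omega N ^ (k * offset N i j))) sums
      (1 / of_nat N * (\<Sum>k<N. exp (dft N a k) * omega N ^ (k * offset N i j)))"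
    by (intro sums_mult sums_sum sums_mult2 exp_converges)
  ultimately show ?thesis by (simp add: sums_unique2)
qed

section \<open>The Laplacian of a circulant graph\<close>

definition circulant_steps :: "nat \<Rightarrow> nat set \<Rightarrow> nat set" where
  "circulant_steps N S = S \<union> (\<lambda>s. N - s) ` S"

lemma circulant_steps_subset:
  assumes "S \<subseteq> {1..N div 2}" "0 < N"
  shows "circulant_steps N S \<subseteq> {1..<N}"
  using assms unfolding circulant_steps_def by force

lemma circulant_edge_iff:
  assumes S: "S \<subseteq> {1..N div 2}" and ij: "i < N" "j < N"
  shows "{i, j} \<in> circulant_edges N S \<longleftrightarrow> offset N j i \<in> circulant_steps N S"
proof -
  have N: "0 < N" using ij by simp
  have SN: "1 \<le> s \<and> s < N" if "s \<in> S" for s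
    using that S N by force
  have fwd: "[int i - int j = int s] (mod int N) \<longleftrightarrow> offset N j i = s" if "s < N" for s
    using that N by (auto simp: cong_def offset_def nat_eq_iff)
  have bwd: "[int j - int i = int s] (mod int N) \<longleftrightarrow> offset N j i = N - s" if "s \<in> S" for s
  proof -
    have "[int j - int i = int s] (mod int N) \<longleftrightarrow> int N dvd (int j - int i - int s)"
      by (simp add: cong_iff_dvd_diff)
    also have "\<dots> \<longleftrightarrow> int N dvd - (int j - int i - int s)"
      by (simp only: dvd_minus_iff)
    also have "\<dots> \<longleftrightarrow> int N dvd (- (int j - int i - int s) + (- 1) * int N)"
      by (simp only: dvd_add_times_triv_right_iff)
    also have "\<dots> \<longleftrightarrow> int N dvd (int i - int j - int (N - s))"
      using SN[OF that] by (simp add: of_nat_diff algebra_simps)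
    also have "\<dots> \<longleftrightarrow> offset N j i = N - s"
      using SN[OF that] fwd[of "N - s"] by (simp add: cong_iff_dvd_diff)
    finally show ?thesis .
  qed
  have "{i, j} \<in> circulant_edges N S \<longleftrightarrow>
      (\<exists>s\<in>S. [int j - int i = int s] (mod int N)) \<or> (\<exists>s\<in>S. [int i - int j = int s] (mod int N))"
    using ij unfolding circulant_edges_def by (auto simp: doubleton_eq_iff)
  then show ?thesis using fwd bwd SN unfolding circulant_steps_def by auto
qed

definition laplacian_column :: "nat \<Rightarrow> nat set \<Rightarrow> nat \<Rightarrow> real" where
  "laplacian_column N S r =
    (if r = 0 then real (circulant_degree N S) else if r \<in> circulant_steps N S then - 1 else 0)"

lemma laplacian_circulant:
  assumes S: "S \<subseteq> {1..N div 2}" and ij: "i < N" "j < N"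
  shows "laplacian N (circulant_edges N S) $$ (i, j) = laplacian_column N S (offset N j i)"
  using assms circulant_edge_iff[OF S ij] offset_eq_0_iff[OF ij(2,1)] degree_circulant[OF S ij(1)]
  by (auto simp: laplacian_def laplacian_column_def)

section \<open>The spectrum of the Laplacian\<close>

lemma dft_laplacian_column:
  assumes S: "S \<subseteq> {1..N div 2}" and N: "0 < N"
  shows "dft N (\<lambda>r. - t * laplacian_column N S r) k =
    of_real (- t) * (of_nat (circulant_degree N S) - (\<Sum>r\<in>circulant_steps N S. omega N ^ (k * r)))"
proof -
  let ?D = "circulant_steps N S"
  have D: "?D \<subseteq> {..<N}" "0 \<notin> ?D" using circulant_steps_subset[OF S N] by auto
  have "(\<Sum>r<N. of_real (laplacian_column N S r) * omega N ^ (k * r))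
      = (\<Sum>r<N. (if r = 0 then of_nat (circulant_degree N S) else 0)
          - (if r \<in> ?D then omega N ^ (k * r) else 0))"
    using D by (intro sum.cong refl) (auto simp: laplacian_column_def)
  also have "\<dots> = of_nat (circulant_degree N S) - (\<Sum>r\<in>?D. omega N ^ (k * r))"
    using N D by (simp add: sum_subtractf sum.inter_restrict[symmetric] Int_absorb1)
  finally show ?thesis
    unfolding dft_def by (simp add: sum_distrib_left[symmetric] mult.assoc sum_negf)
qed

lemma omega_power_add_reflected:
  assumes "s \<le> N"
  shows "omega N ^ (k * s) + omega N ^ (k * (N - s)) =
    of_real (2 * cos (2 * pi * real s * real k / real N))"
proof -
  have "omega N ^ (k * s) * omega N ^ (k * (N - s)) = (omega N ^ N) ^ k"
    using assms by (simp flip: power_add power_mult add: distrib_left[symmetric] mult.commute)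
  then have "omega N ^ (k * (N - s)) = inverse (omega N ^ (k * s))"
    by (simp add: omega_power_N inverse_unique)
  then show ?thesis
    by (simp add: omega_power complex_eq_iff mult_ac)
qed

text \<open>The hypothesis says that no step is its own reflection, so that \<open>S\<close> and \<open>N - S\<close> are
  disjoint and the steps come in pairs.\<close>

lemma sum_circulant_steps:
  assumes S: "S \<subseteq> {1..N div 2}" and half: "\<not> (even N \<and> N div 2 \<in> S)"
  shows "(\<Sum>r\<in>circulant_steps N S. omega N ^ (k * r)) =
    of_real (2 * (\<Sum>s\<in>S. cos (2 * pi * real s * real k / real N)))"
proof -
  have fin: "finite S" using S finite_subset by blast
  have le: "s \<le> N div 2" "s \<le> N" if "s \<in> S" for s using that S by fastforce+
  have inj: "inj_on (\<lambda>s. N - s) S" by (intro inj_onI) (metis diff_diff_cancel le(2))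
  have disj: "S \<inter> (\<lambda>s. N - s) ` S = {}"
  proof (rule ccontr)
    assume "S \<inter> (\<lambda>s. N - s) ` S \<noteq> {}"
    then obtain s where s: "s \<in> S" "N - s \<in> S" by blast
    then have "s \<le> N div 2" "N - s \<le> N div 2" using le by auto
    then have "even N" "s = N div 2" by presburger+
    then show False using half s by simp
  qed
  have "(\<Sum>r\<in>circulant_steps N S. omega N ^ (k * r))
      = (\<Sum>s\<in>S. omega N ^ (k * s)) + (\<Sum>s\<in>S. omega N ^ (k * (N - s)))"
    unfolding circulant_steps_def using fin disj inj
    by (simp add: sum.union_disjoint sum.reindex)
  also have "\<dots> = (\<Sum>s\<in>S. of_real (2 * cos (2 * pi * real s * real k / real N)))"
    unfolding sum.distrib[symmetric] using le by (intro sum.cong refl omega_power_add_reflected)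
  finally show ?thesis by (simp add: sum_distrib_left)
qed

text \<open>The step \<open>N / 2\<close> stands alone; the other steps fall under the paired case. Its power of
  \<open>\<omega>\<close> is \<open>\<plusminus>1\<close>, hence equal to its real part.\<close>

lemma sum_circulant_steps_half:
  assumes S: "S \<subseteq> {1..N div 2}" and half: "even N" "N div 2 \<in> S"
  shows "(\<Sum>r\<in>circulant_steps N S. omega N ^ (k * r)) =
    of_real (2 * (\<Sum>s\<in>S - {N div 2}. cos (2 * pi * real s * real k / real N))
      + cos (2 * pi * real (N div 2) * real k / real N))"
proof -
  let ?h = "N div 2" and ?T = "S - {N div 2}"
  have h: "N - ?h = ?h" "?h \<le> N" using half by presburger+
  have T: "?T \<subseteq> {1..N div 2}" using S by auto
  have steps: "circulant_steps N S = insert ?h (circulant_steps N ?T)"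
  proof -
    have "S = insert ?h ?T" using half by auto
    then have "circulant_steps N S = circulant_steps N (insert ?h ?T)" by simp
    also have "\<dots> = insert ?h (circulant_steps N ?T)"
      unfolding circulant_steps_def image_insert h(1) by blast
    finally show ?thesis .
  qed
  have notin: "?h \<notin> circulant_steps N ?T"
  proof
    assume "?h \<in> circulant_steps N ?T"
    then obtain s where s: "s \<in> ?T" "?h = N - s" unfolding circulant_steps_def by blast
    then have "s \<le> ?h" using T by auto
    then have "s = ?h" using s h by linarith
    then show False using s by simp
  qed
  have fin: "finite (circulant_steps N ?T)"
    using S finite_subset by (auto simp: circulant_steps_def)
  have "omega N ^ (k * ?h) = of_real (cos (2 * pi * real ?h * real k / real N))"
    using omega_power_add_reflected[OF h(2), of k] unfolding h(1) by simp
  then show ?thesis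
    unfolding steps sum.insert[OF fin notin] using sum_circulant_steps[OF T, of k] by simp
qed

section \<open>Heat diffusion\<close>

text \<open>The two cases of the theorem differ only in the closed form \<open>ev\<close> of the eigenvalues.\<close>

lemma heat_transition_circulant:
  assumes S: "S \<subseteq> {1..N div 2}" and ij: "i < N" "j < N"
    and ev: "\<And>k. of_real (ev k) =
      of_nat (circulant_degree N S) - (\<Sum>r\<in>circulant_steps N S. omega N ^ (k * r))"
  shows "complex_of_real (heat_transition N (circulant_edges N S) t $$ (i, j)) =
    1 / of_nat N * (\<Sum>k = 0..<N. complex_of_real (exp (- t * ev k)) * omega N ^ (k * offset N i j))"
proof -
  let ?L = "laplacian N (circulant_edges N S)"
  let ?a = "\<lambda>r. - t * laplacian_column N S r"
  have L: "?L \<in> carrier_mat N N" by (simp add: laplacian_def)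
  have "complex_of_real (mat_exp ((- t) \<cdot>\<^sub>m ?L) $$ (i, j)) =
      1 / of_nat N * (\<Sum>k<N. exp (dft N ?a k) * omega N ^ (k * offset N i j))"
    using L ij laplacian_circulant[OF S] by (intro circulant_exp) auto
  moreover have "exp (dft N ?a k) = complex_of_real (exp (- t * ev k))" for k
  proof -
    have "dft N ?a k = of_real (- t * ev k)"
      using dft_laplacian_column[OF S, of t k] ij ev[of k] by simp
    then show ?thesis by (simp only: exp_of_real)
  qed
  ultimately show ?thesis by (simp add: heat_transition_def atLeast0LessThan)
qed

theorem proposition3p9:
  fixes N :: nat and S :: "nat set" and i j :: nat and t :: real
  assumes "S \<subseteq> {1..N div 2}" and "i < N" and "j < N" and "t \<ge> 0"
  shows "(\<not> (even N \<and> N div 2 \<in> S) \<longrightarrow>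
            complex_of_real (heat_transition N (circulant_edges N S) t $$ (i, j)) =
              1 / of_nat N *
              (\<Sum>k = 0..<N. complex_of_real (exp (- t * circulant_eigval N S (k + 1)))
                 * omega N ^ (k * nat ((int j - int i) mod int N))))
       \<and> ((even N \<and> N div 2 \<in> S) \<longrightarrow>
            complex_of_real (heat_transition N (circulant_edges N S) t $$ (i, j)) =
              1 / of_nat N *
              (\<Sum>k = 0..<N. complex_of_real (exp (- t * circulant_eigval_half N S (k + 1)))
                 * omega N ^ (k * nat ((int j - int i) mod int N))))"
proof (intro conjI impI; fold offset_def)
  assume "\<not> (even N \<and> N div 2 \<in> S)"
  then show "complex_of_real (heat_transition N (circulant_edges N S) t $$ (i, j)) =
      1 / of_nat N * (\<Sum>k = 0..<N. complex_of_real (exp (- t * circulant_eigval N S (k + 1)))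
        * omega N ^ (k * offset N i j))"
    using assms
    by (intro heat_transition_circulant) (simp_all add: sum_circulant_steps circulant_eigval_def)
next
  assume "even N \<and> N div 2 \<in> S"
  then show "complex_of_real (heat_transition N (circulant_edges N S) t $$ (i, j)) =
      1 / of_nat N * (\<Sum>k = 0..<N. complex_of_real (exp (- t * circulant_eigval_half N S (k + 1)))
        * omega N ^ (k * offset N i j))"
    using assms
    by (intro heat_transition_circulant)
      (simp_all add: sum_circulant_steps_half circulant_eigval_half_def)
qed

end
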